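(* Any split-generated category with weak equivalences $(\mathcal{C},\mathcal{W})$ satisfies the Whitehead condition.
   Context: A category with weak equivalences is a pair $(\mathcal{C},\mathcal{W})$ where $\mathcal{W}$ is a family of arrows of the category $\mathcal{C}$ (the weak equivalences) containing all identities and having the two out of three property: for composable $f,g$, if two of $f,g,gf$ are in $\mathcal{W}$ then so is the third. An arrow $s:X\to Y$ is a section if there is $r:Y\to X$ with $rs=id_X$; an arrow $r:Y\to X$ is a retraction if there is $s:X\to Y$ with $rs=id_X$. An arrow splits if it is a section or a retraction. $(\mathcal{C},\mathcal{W})$ is split-generated if every arrow of $\mathcal{W}$ is a (finite) composition of weak equivalences that split. $\gamma:\mathcal{C}\to Ho(\mathcal{C})$ denotes the localization of $\mathcal{C}$ with respect to $\mathcal{W}$ (the universal functor sending arrows of $\mathcal{W}$ to isomorphisms; size issues are ignored). The homotopy relation $\sim_{\mathcal{W}}$ is the congruence relating parallel arrows $f,g$ of $\mathcal{C}$ if and only if $\gamma f=\gamma g$. $(\mathcal{C},\mathcal{W})$ satisfies the Whitehead condition if the following equivalent conditions hold: (1) there is a congruence $R$ in $\mathcal{C}$ (equivalence relations on hom-sets, compatible with composition) such that the quotient functor $\mathcal{C}\to\mathcal{C}/R$ is isomorphic to $\gamma$ as a category under $\mathcal{C}$; (2) the induced functor $\mathcal{C}/{\sim_{\mathcal{W}}}\to Ho(\mathcal{C})$ is an isomorphism of categories; (3) every weak equivalence is a homotopical equivalence, i.e. for every $f:X\to Y$ in $\mathcal{W}$ there is $g:Y\to X$ in $\mathcal{C}$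 with $gf\sim_{\mathcal{W}}id_X$ and $fg\sim_{\mathcal{W}}id_Y$. *)

theory Defs
  imports Main
begin

section \<open>Categories and functors\<close>

text \<open>\<open>g \<cdot>\<^bsub>C\<^esub> f\<close> is \<open>f\<close> followed by \<open>g\<close>.  All operations are only meaningful on the carriers \<open>Obj C\<close> and \<open>Arr C\<close>.\<close>

record ('o, 'a) category =
  Obj :: "'o set"
  Arr :: "'a set"
  Dom :: "'a \<Rightarrow> 'o"
  Cod :: "'a \<Rightarrow> 'o"
  Id :: "'o \<Rightarrow> 'a"
  Comp :: "'a \<Rightarrow> 'a \<Rightarrow> 'a"  (infixl "\<cdot>\<index>" 70)

locale category =
  fixes C :: "('o, 'a) category" (structure)
  assumes Dom_in: "f \<in> Arr C \<Longrightarrow> Dom C f \<in> Obj C"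
    and Cod_in: "f \<in> Arr C \<Longrightarrow> Cod C f \<in> Obj C"
    and Id_in: "x \<in> Obj C \<Longrightarrow> Id C x \<in> Arr C"
    and Dom_Id: "x \<in> Obj C \<Longrightarrow> Dom C (Id C x) = x"
    and Cod_Id: "x \<in> Obj C \<Longrightarrow> Cod C (Id C x) = x"
    and Comp_in: "\<lbrakk>f \<in> Arr C; g \<in> Arr C; Cod C f = Dom C g\<rbrakk> \<Longrightarrow> g \<cdot> f \<in> Arr C"
    and Dom_Comp: "\<lbrakk>f \<in> Arr C; g \<in> Arr C; Cod C f = Dom C g\<rbrakk> \<Longrightarrow> Dom C (g \<cdot> f) = Dom C f"
    and Cod_Comp: "\<lbrakk>f \<in> Arr C; g \<in> Arr C; Cod C f = Dom C g\<rbrakk> \<Longrightarrow> Cod C (g \<cdot> f) = Cod C g"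
    and Comp_Id: "f \<in> Arr C \<Longrightarrow> f \<cdot> Id C (Dom C f) = f"
    and Id_Comp: "f \<in> Arr C \<Longrightarrow> Id C (Cod C f) \<cdot> f = f"
    and Comp_assoc: "\<lbrakk>f \<in> Arr C; g \<in> Arr C; h \<in> Arr C; Cod C f = Dom C g; Cod C g = Dom C h\<rbrakk>
        \<Longrightarrow> (h \<cdot> g) \<cdot> f = h \<cdot> (g \<cdot> f)"

lemmas (in category) cat_simps [simp] =
  Dom_in Cod_in Id_in Dom_Id Cod_Id Comp_in Dom_Comp Cod_Comp Comp_Id Id_Comp

definition inverse_arrows :: "('o, 'a) category \<Rightarrow> 'a \<Rightarrow> 'a \<Rightarrow> bool" where
  "inverse_arrows C f g \<longleftrightarrow> f \<in> Arr C \<and> g \<in> Arr C \<and> Dom C g = Cod C f \<and> Cod C g = Dom C f \<and>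
     g \<cdot>\<^bsub>C\<^esub> f = Id C (Dom C f) \<and> f \<cdot>\<^bsub>C\<^esub> g = Id C (Cod C f)"

definition isomorphism :: "('o, 'a) category \<Rightarrow> 'a \<Rightarrow> bool" where
  "isomorphism C f \<longleftrightarrow> (\<exists>g. inverse_arrows C f g)"

record ('o, 'a, 'p, 'b) fnctr =
  omap :: "'o \<Rightarrow> 'p"
  amap :: "'a \<Rightarrow> 'b"

definition is_functor ::
    "('o, 'a) category \<Rightarrow> ('p, 'b) category \<Rightarrow> ('o, 'a, 'p, 'b) fnctr \<Rightarrow> bool" where
  "is_functor C D F \<longleftrightarrow>
     (\<forall>x\<in>Obj C. omap F x \<in> Obj D \<and> amap F (Id C x) = Id D (omap F x)) \<and>
     (\<forall>f\<in>Arr C. amap F f \<in> Arr D \<and> Dom D (amap F f) = omap F (Dom C f) \<and>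
        Cod D (amap F f) = omap F (Cod C f)) \<and>
     (\<forall>f\<in>Arr C. \<forall>g\<in>Arr C. Cod C f = Dom C g \<longrightarrow>
        amap F (g \<cdot>\<^bsub>C\<^esub> f) = amap F g \<cdot>\<^bsub>D\<^esub> amap F f)"

definition functor_eq ::
    "('o, 'a) category \<Rightarrow> ('o, 'a, 'p, 'b) fnctr \<Rightarrow> ('o, 'a, 'p, 'b) fnctr \<Rightarrow> bool" where
  "functor_eq C F G \<longleftrightarrow>
     (\<forall>x\<in>Obj C. omap F x = omap G x) \<and> (\<forall>f\<in>Arr C. amap F f = amap G f)"

definition id_functor :: "('o, 'a, 'o, 'a) fnctr" where
  "id_functor = \<lparr>omap = id, amap = id\<rparr>"

definition comp_functor ::
    "('p, 'b, 'q, 'c) fnctr \<Rightarrow> ('o, 'a, 'p, 'b) fnctr \<Rightarrow> ('o, 'a, 'q, 'c) fnctr" where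
  "comp_functor G F = \<lparr>omap = omap G \<circ> omap F, amap = amap G \<circ> amap F\<rparr>"

definition isomorphism_of_categories ::
    "('o, 'a) category \<Rightarrow> ('p, 'b) category \<Rightarrow> ('o, 'a, 'p, 'b) fnctr \<Rightarrow> bool" where
  "isomorphism_of_categories C D F \<longleftrightarrow> is_functor C D F \<and>
     (\<exists>G. is_functor D C G \<and> functor_eq C (comp_functor G F) id_functor \<and>
          functor_eq D (comp_functor F G) id_functor)"


section \<open>Congruences and quotient categories\<close>

definition parallel :: "('o, 'a) category \<Rightarrow> 'a \<Rightarrow> 'a \<Rightarrow> bool" where
  "parallel C f g \<longleftrightarrow> f \<in> Arr C \<and> g \<in> Arr C \<and> Dom C f = Dom C g \<and> Cod C f = Cod C g"

text \<open>A family of equivalence relations on the hom-sets is encoded as one equivalence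
  relation on \<open>Arr C\<close> relating only parallel arrows.\<close>

definition congruence :: "('o, 'a) category \<Rightarrow> ('a \<times> 'a) set \<Rightarrow> bool" where
  "congruence C R \<longleftrightarrow> equiv (Arr C) R \<and> (\<forall>(f, g)\<in>R. parallel C f g) \<and>
     (\<forall>(f, f')\<in>R. \<forall>(g, g')\<in>R. Cod C f = Dom C g \<longrightarrow> (g \<cdot>\<^bsub>C\<^esub> f, g' \<cdot>\<^bsub>C\<^esub> f') \<in> R)"

definition quotient_category ::
    "('o, 'a) category \<Rightarrow> ('a \<times> 'a) set \<Rightarrow> ('o, 'a set) category" where
  "quotient_category C R =
     \<lparr>Obj = Obj C,
      Arr = Arr C // R,
      Dom = (\<lambda>A. the_elem (Dom C ` A)),
      Cod = (\<lambda>A. the_elem (Cod C ` A)),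
      Id = (\<lambda>x. R `` {Id C x}),
      Comp = (\<lambda>B A. \<Union>g\<in>B. \<Union>f\<in>A. R `` {g \<cdot>\<^bsub>C\<^esub> f})\<rparr>"

definition quotient_functor :: "('a \<times> 'a) set \<Rightarrow> ('o, 'a, 'o, 'a set) fnctr" where
  "quotient_functor R = \<lparr>omap = id, amap = (\<lambda>f. R `` {f})\<rparr>"

text \<open>The functor on \<open>quotient_category C R\<close> induced by a functor that is constant on the
  classes of \<open>R\<close>.\<close>

definition induced_functor :: "('o, 'a, 'p, 'b) fnctr \<Rightarrow> ('o, 'a set, 'p, 'b) fnctr" where
  "induced_functor F = \<lparr>omap = omap F, amap = (\<lambda>A. the_elem (amap F ` A))\<rparr>"

text \<open>The least congruence containing a relation \<open>S\<close> between parallel arrows.\<close>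

inductive_set generated_congruence :: "('o, 'a) category \<Rightarrow> ('a \<times> 'a) set \<Rightarrow> ('a \<times> 'a) set"
  for C :: "('o, 'a) category" and S :: "('a \<times> 'a) set" where
  base: "(f, g) \<in> S \<Longrightarrow> (f, g) \<in> generated_congruence C S"
| refl: "f \<in> Arr C \<Longrightarrow> (f, f) \<in> generated_congruence C S"
| sym: "(f, g) \<in> generated_congruence C S \<Longrightarrow> (g, f) \<in> generated_congruence C S"
| trans: "\<lbrakk>(f, g) \<in> generated_congruence C S; (g, h) \<in> generated_congruence C S\<rbrakk>
    \<Longrightarrow> (f, h) \<in> generated_congruence C S"
| comp: "\<lbrakk>(f, f') \<in> generated_congruence C S; (g, g') \<in> generated_congruence C S;
     Cod C f = Dom C g\<rbrakk> \<Longrightarrow> (g \<cdot>\<^bsub>C\<^esub> f, g' \<cdot>\<^bsub>C\<^esub> f') \<in> generated_congruence C S"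


section \<open>The localization\<close>

text \<open>The localization is built as the category of zigzags, in which the legs pointing
  backwards lie in \<open>W\<close>, modulo the usual relations.  A zigzag carries its two end objects,
  so that there is one empty zigzag at each object.  The universal property, against
  categories of arbitrary type, is proved below (\<open>localization_universal\<close>).\<close>

datatype 'a leg = Fwd 'a | Bwd 'a

fun leg_src :: "('o, 'a) category \<Rightarrow> 'a leg \<Rightarrow> 'o" where
  "leg_src C (Fwd f) = Dom C f"
| "leg_src C (Bwd w) = Cod C w"

fun leg_tgt :: "('o, 'a) category \<Rightarrow> 'a leg \<Rightarrow> 'o" where
  "leg_tgt C (Fwd f) = Cod C f"
| "leg_tgt C (Bwd w) = Dom C w"

fun leg_ok :: "('o, 'a) category \<Rightarrow> 'a set \<Rightarrow> 'a leg \<Rightarrow> bool" where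
  "leg_ok C W (Fwd f) \<longleftrightarrow> f \<in> Arr C"
| "leg_ok C W (Bwd w) \<longleftrightarrow> w \<in> W"

fun zigzag :: "('o, 'a) category \<Rightarrow> 'a set \<Rightarrow> 'o \<Rightarrow> 'a leg list \<Rightarrow> 'o \<Rightarrow> bool" where
  "zigzag C W x [] y \<longleftrightarrow> x \<in> Obj C \<and> x = y"
| "zigzag C W x (l # ls) y \<longleftrightarrow> leg_ok C W l \<and> leg_src C l = x \<and> zigzag C W (leg_tgt C l) ls y"

definition zigzag_category ::
    "('o, 'a) category \<Rightarrow> 'a set \<Rightarrow> ('o, 'o \<times> 'a leg list \<times> 'o) category" where
  "zigzag_category C W =
     \<lparr>Obj = Obj C,
      Arr = {(x, p, y). zigzag C W x p y},
      Dom = (\<lambda>(x, p, y). x),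
      Cod = (\<lambda>(x, p, y). y),
      Id = (\<lambda>x. (x, [], x)),
      Comp = (\<lambda>(y, q, z) (x, p, y'). (x, p @ q, z))\<rparr>"

inductive_set zigzag_relations ::
    "('o, 'a) category \<Rightarrow> 'a set \<Rightarrow> (('o \<times> 'a leg list \<times> 'o) \<times> ('o \<times> 'a leg list \<times> 'o)) set"
  for C :: "('o, 'a) category" and W :: "'a set" where
  "x \<in> Obj C \<Longrightarrow> ((x, [Fwd (Id C x)], x), (x, [], x)) \<in> zigzag_relations C W"
| "\<lbrakk>f \<in> Arr C; g \<in> Arr C; Cod C f = Dom C g\<rbrakk> \<Longrightarrow>
    ((Dom C f, [Fwd f, Fwd g], Cod C g), (Dom C f, [Fwd (g \<cdot>\<^bsub>C\<^esub> f)], Cod C g))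
      \<in> zigzag_relations C W"
| "w \<in> W \<Longrightarrow> ((Dom C w, [Fwd w, Bwd w], Dom C w), (Dom C w, [], Dom C w)) \<in> zigzag_relations C W"
| "w \<in> W \<Longrightarrow> ((Cod C w, [Bwd w, Fwd w], Cod C w), (Cod C w, [], Cod C w)) \<in> zigzag_relations C W"

definition zigzag_congruence ::
    "('o, 'a) category \<Rightarrow> 'a set \<Rightarrow> (('o \<times> 'a leg list \<times> 'o) \<times> ('o \<times> 'a leg list \<times> 'o)) set" where
  "zigzag_congruence C W = generated_congruence (zigzag_category C W) (zigzag_relations C W)"

definition Ho ::
    "('o, 'a) category \<Rightarrow> 'a set \<Rightarrow> ('o, ('o \<times> 'a leg list \<times> 'o) set) category" where
  "Ho C W = quotient_category (zigzag_category C W) (zigzag_congruence C W)"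

definition localization ::
    "('o, 'a) category \<Rightarrow> 'a set \<Rightarrow> ('o, 'a, 'o, ('o \<times> 'a leg list \<times> 'o) set) fnctr" where
  "localization C W =
     \<lparr>omap = id, amap = (\<lambda>f. zigzag_congruence C W `` {(Dom C f, [Fwd f], Cod C f)})\<rparr>"


section \<open>Categories with weak equivalences\<close>

definition category_with_weak_equivalences :: "('o, 'a) category \<Rightarrow> 'a set \<Rightarrow> bool" where
  "category_with_weak_equivalences C W \<longleftrightarrow> category C \<and> W \<subseteq> Arr C \<and> (\<forall>x\<in>Obj C. Id C x \<in> W) \<and>
     (\<forall>f\<in>Arr C. \<forall>g\<in>Arr C. Cod C f = Dom C g \<longrightarrow>
        (f \<in> W \<and> g \<in> W \<longrightarrow> g \<cdot>\<^bsub>C\<^esub> f \<in> W) \<and>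
        (f \<in> W \<and> g \<cdot>\<^bsub>C\<^esub> f \<in> W \<longrightarrow> g \<in> W) \<and>
        (g \<in> W \<and> g \<cdot>\<^bsub>C\<^esub> f \<in> W \<longrightarrow> f \<in> W))"

definition is_section :: "('o, 'a) category \<Rightarrow> 'a \<Rightarrow> bool" where
  "is_section C s \<longleftrightarrow> s \<in> Arr C \<and>
     (\<exists>r\<in>Arr C. Dom C r = Cod C s \<and> Cod C r = Dom C s \<and> r \<cdot>\<^bsub>C\<^esub> s = Id C (Dom C s))"

definition is_retraction :: "('o, 'a) category \<Rightarrow> 'a \<Rightarrow> bool" where
  "is_retraction C r \<longleftrightarrow> r \<in> Arr C \<and>
     (\<exists>s\<in>Arr C. Dom C s = Cod C r \<and> Cod C s = Dom C r \<and> r \<cdot>\<^bsub>C\<^esub> s = Id C (Cod C r))"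

definition splits :: "('o, 'a) category \<Rightarrow> 'a \<Rightarrow> bool" where
  "splits C f \<longleftrightarrow> is_section C f \<or> is_retraction C f"

inductive_set finite_compositions :: "('o, 'a) category \<Rightarrow> 'a set \<Rightarrow> 'a set"
  for C :: "('o, 'a) category" and S :: "'a set" where
  "f \<in> S \<Longrightarrow> f \<in> finite_compositions C S"
| "\<lbrakk>f \<in> finite_compositions C S; g \<in> finite_compositions C S; Cod C f = Dom C g\<rbrakk>
    \<Longrightarrow> g \<cdot>\<^bsub>C\<^esub> f \<in> finite_compositions C S"

definition split_generated :: "('o, 'a) category \<Rightarrow> 'a set \<Rightarrow> bool" where
  "split_generated C W \<longleftrightarrow> W \<subseteq> finite_compositions C {w \<in> W. splits C w}"

definition homotopy_relation :: "('o, 'a) category \<Rightarrow> 'a set \<Rightarrow> ('a \<times> 'a) set" where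
  "homotopy_relation C W =
     {(f, g). parallel C f g \<and> amap (localization C W) f = amap (localization C W) g}"

definition homotopical_equivalence :: "('o, 'a) category \<Rightarrow> 'a set \<Rightarrow> 'a \<Rightarrow> bool" where
  "homotopical_equivalence C W f \<longleftrightarrow> f \<in> Arr C \<and>
     (\<exists>g\<in>Arr C. Dom C g = Cod C f \<and> Cod C g = Dom C f \<and>
        (g \<cdot>\<^bsub>C\<^esub> f, Id C (Dom C f)) \<in> homotopy_relation C W \<and>
        (f \<cdot>\<^bsub>C\<^esub> g, Id C (Cod C f)) \<in> homotopy_relation C W)"

definition localization_is_quotient :: "('o, 'a) category \<Rightarrow> 'a set \<Rightarrow> bool" where
  "localization_is_quotient C W \<longleftrightarrow>
     (\<exists>R. congruence C R \<and>
        (\<exists>F. isomorphism_of_categories (quotient_category C R) (Ho C W) F \<and>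
             functor_eq C (comp_functor F (quotient_functor R)) (localization C W)))"

definition homotopy_quotient_is_Ho :: "('o, 'a) category \<Rightarrow> 'a set \<Rightarrow> bool" where
  "homotopy_quotient_is_Ho C W \<longleftrightarrow>
     isomorphism_of_categories (quotient_category C (homotopy_relation C W)) (Ho C W)
       (induced_functor (localization C W))"

definition weak_equivalences_are_homotopical :: "('o, 'a) category \<Rightarrow> 'a set \<Rightarrow> bool" where
  "weak_equivalences_are_homotopical C W \<longleftrightarrow> (\<forall>f\<in>W. homotopical_equivalence C W f)"

text \<open>The three conditions are equivalent; all of them are demanded, so that the definition
  does not depend on that fact.\<close>

definition Whitehead_condition :: "('o, 'a) category \<Rightarrow> 'a set \<Rightarrow> bool" where
  "Whitehead_condition C W \<longleftrightarrow> localization_is_quotient C W \<and> homotopy_quotient_is_Ho C W \<and>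
     weak_equivalences_are_homotopical C W"


section \<open>Quotient categories: basic facts\<close>

lemma congruenceD:
  assumes "congruence C R"
  shows "equiv (Arr C) R" "(f, g) \<in> R \<Longrightarrow> parallel C f g"
    "\<lbrakk>(f, f') \<in> R; (g, g') \<in> R; Cod C f = Dom C g\<rbrakk> \<Longrightarrow> (g \<cdot>\<^bsub>C\<^esub> f, g' \<cdot>\<^bsub>C\<^esub> f') \<in> R"
  using assms unfolding congruence_def by blast+

lemma quotient_sel [simp]:
  "Obj (quotient_category C R) = Obj C"
  "Arr (quotient_category C R) = Arr C // R"
  "Id (quotient_category C R) x = R `` {Id C x}"
  by (simp_all add: quotient_category_def)

lemma the_elem_const:
  assumes "a \<in> A" "\<And>b. b \<in> A \<Longrightarrow> f b = f a"
  shows "the_elem (f ` A) = f a"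
proof -
  have "f ` A = {f a}" using assms by blast
  then show ?thesis by simp
qed

lemma class_self:
  assumes "congruence C R" "f \<in> Arr C"
  shows "f \<in> R `` {f}"
  using equiv_class_self[OF congruenceD(1)[OF assms(1)] assms(2)] .

lemma quotient_Dom [simp]:
  assumes "congruence C R" "f \<in> Arr C"
  shows "Dom (quotient_category C R) (R `` {f}) = Dom C f"
proof -
  have "Dom C g = Dom C f" if "g \<in> R `` {f}" for g
    using congruenceD(2)[OF assms(1), of f g] that by (simp add: parallel_def)
  then have "the_elem (Dom C ` (R `` {f})) = Dom C f"
    by (rule the_elem_const[OF class_self[OF assms]])
  then show ?thesis by (simp add: quotient_category_def)
qed

lemma quotient_Cod [simp]:
  assumes "congruence C R" "f \<in> Arr C"
  shows "Cod (quotient_category C R) (R `` {f}) = Cod C f"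
proof -
  have "Cod C g = Cod C f" if "g \<in> R `` {f}" for g
    using congruenceD(2)[OF assms(1), of f g] that by (simp add: parallel_def)
  then have "the_elem (Cod C ` (R `` {f})) = Cod C f"
    by (rule the_elem_const[OF class_self[OF assms]])
  then show ?thesis by (simp add: quotient_category_def)
qed

lemma quotient_Comp [simp]:
  assumes R: "congruence C R" and f: "f \<in> Arr C" and g: "g \<in> Arr C" and fg: "Cod C f = Dom C g"
  shows "(R `` {g}) \<cdot>\<^bsub>quotient_category C R\<^esub> (R `` {f}) = R `` {g \<cdot>\<^bsub>C\<^esub> f}"
proof -
  have "R `` {g' \<cdot>\<^bsub>C\<^esub> f'} = R `` {g \<cdot>\<^bsub>C\<^esub> f}" if "(f, f') \<in> R" "(g, g') \<in> R" for f' g'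
    using equiv_class_eq[OF congruenceD(1)[OF R] congruenceD(3)[OF R that fg]] by simp
  then have "(\<Union>g'\<in>R `` {g}. \<Union>f'\<in>R `` {f}. R `` {g' \<cdot>\<^bsub>C\<^esub> f'}) = R `` {g \<cdot>\<^bsub>C\<^esub> f}"
    using class_self[OF R f] class_self[OF R g] by blast
  then show ?thesis by (simp add: quotient_category_def)
qed

lemma quotient_Arr_cases:
  assumes "A \<in> Arr C // R"
  obtains f where "f \<in> Arr C" "A = R `` {f}"
  using assms by (auto elim: quotientE)

lemma quotient_is_category:
  assumes "category C" and R: "congruence C R"
  shows "category (quotient_category C R)"
proof -
  interpret category C by fact
  show ?thesis
  proof (unfold_locales, goal_cases)
    case (1 A) then show ?case by (auto elim!: quotient_Arr_cases simp: R)
  next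
    case (2 A) then show ?case by (auto elim!: quotient_Arr_cases simp: R)
  next
    case (3 x) then show ?case by (simp add: quotientI)
  next
    case (4 x) then show ?case by (simp add: R)
  next
    case (5 x) then show ?case by (simp add: R)
  next
    case (6 A B) then show ?case by (auto elim!: quotient_Arr_cases simp: R quotientI)
  next
    case (7 A B) then show ?case by (auto elim!: quotient_Arr_cases simp: R)
  next
    case (8 A B) then show ?case by (auto elim!: quotient_Arr_cases simp: R)
  next
    case (9 A) then show ?case by (auto elim!: quotient_Arr_cases simp: R)
  next
    case (10 A) then show ?case by (auto elim!: quotient_Arr_cases simp: R)
  next
    case (11 A B E) then show ?case
      by (auto elim!: quotient_Arr_cases simp: R Comp_assoc)
  qed
qed

lemma quotient_functor_is_functor:
  assumes "category C" and R: "congruence C R"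
  shows "is_functor C (quotient_category C R) (quotient_functor R)"
proof -
  interpret category C by fact
  show ?thesis
    unfolding is_functor_def quotient_functor_def by (simp add: R quotientI)
qed

lemma is_functorD:
  assumes "is_functor C D F"
  shows "x \<in> Obj C \<Longrightarrow> omap F x \<in> Obj D" "x \<in> Obj C \<Longrightarrow> amap F (Id C x) = Id D (omap F x)"
    "f \<in> Arr C \<Longrightarrow> amap F f \<in> Arr D" "f \<in> Arr C \<Longrightarrow> Dom D (amap F f) = omap F (Dom C f)"
    "f \<in> Arr C \<Longrightarrow> Cod D (amap F f) = omap F (Cod C f)"
    "\<lbrakk>f \<in> Arr C; g \<in> Arr C; Cod C f = Dom C g\<rbrakk>
      \<Longrightarrow> amap F (g \<cdot>\<^bsub>C\<^esub> f) = amap F g \<cdot>\<^bsub>D\<^esub> amap F f"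
  using assms unfolding is_functor_def by blast+

lemma induced_functor_class:
  assumes R: "congruence C R" and con: "\<And>f g. (f, g) \<in> R \<Longrightarrow> amap F f = amap F g"
    and f: "f \<in> Arr C"
  shows "amap (induced_functor F) (R `` {f}) = amap F f"
proof -
  have "amap F g = amap F f" if "g \<in> R `` {f}" for g
    using con[of f g] that by simp
  then have "the_elem (amap F ` (R `` {f})) = amap F f"
    by (rule the_elem_const[OF class_self[OF R f]])
  then show ?thesis by (simp add: induced_functor_def)
qed

lemma induced_functor_is_functor:
  assumes "category C" and R: "congruence C R" and F: "is_functor C D F"
    and con: "\<And>f g. (f, g) \<in> R \<Longrightarrow> amap F f = amap F g"
  shows "is_functor (quotient_category C R) D (induced_functor F)"
proof -
  interpret category C by fact
  note [simp] = induced_functor_class[OF R con] is_functorD[OF F]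
  have [simp]: "omap (induced_functor F) = omap F" by (simp add: induced_functor_def)
  show ?thesis unfolding is_functor_def
    by (auto elim!: quotient_Arr_cases simp: R)
qed

lemma generated_congruence_is_congruence:
  assumes "category C" and S: "\<And>f g. (f, g) \<in> S \<Longrightarrow> parallel C f g"
  shows "congruence C (generated_congruence C S)"
proof -
  interpret category C by fact
  have par: "parallel C f g" if "(f, g) \<in> generated_congruence C S" for f g
    using that
  proof induction
    case (base f g) then show ?case by (rule S)
  qed (auto simp: parallel_def)
  have "equiv (Arr C) (generated_congruence C S)"
  proof (rule equivI)
    show "generated_congruence C S \<subseteq> Arr C \<times> Arr C"
      using par unfolding parallel_def by auto
    show "refl_on (Arr C) (generated_congruence C S)"
      by (auto simp: refl_on_def intro: generated_congruence.refl)
    show "sym (generated_congruence C S)"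
      by (auto simp: sym_def intro: generated_congruence.sym)
    show "trans (generated_congruence C S)"
      unfolding trans_def by (blast intro: generated_congruence.trans)
  qed
  then show ?thesis
    unfolding congruence_def using par by (auto intro: generated_congruence.comp)
qed

lemma generated_congruence_least:
  assumes "congruence C R" "S \<subseteq> R"
  shows "generated_congruence C S \<subseteq> R"
proof -
  note e = congruenceD(1)[OF assms(1)]
  have "(f, g) \<in> R" if "(f, g) \<in> generated_congruence C S" for f g
    using that
  proof induction
    case (base f g) then show ?case using assms by auto
  next
    case (refl f) then show ?case using e by (auto simp: equiv_def refl_on_def)
  next
    case (sym f g) then show ?case using e by (auto simp: equiv_def dest: symD)
  next
    case (trans f g h) then show ?case using e by (auto simp: equiv_def dest: transD)
  next
    case (comp f f' g g') then show ?case using congruenceD(3)[OF assms(1)] by blast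
  qed
  then show ?thesis by auto
qed


section \<open>The universal property of the localization\<close>

lemma zigzag_sel [simp]:
  "Obj (zigzag_category C W) = Obj C"
  "(x, p, y) \<in> Arr (zigzag_category C W) \<longleftrightarrow> zigzag C W x p y"
  "Dom (zigzag_category C W) (x, p, y) = x"
  "Cod (zigzag_category C W) (x, p, y) = y"
  "Id (zigzag_category C W) x = (x, [], x)"
  "(y', q, z) \<cdot>\<^bsub>zigzag_category C W\<^esub> (x, p, y) = (x, p @ q, z)"
  by (simp_all add: zigzag_category_def)

lemma zigzag_append:
  "zigzag C W x p y \<Longrightarrow> zigzag C W y q z \<Longrightarrow> zigzag C W x (p @ q) z"
  by (induction p arbitrary: x) auto

locale category_with_arrows = category C for C :: "('o, 'a) category" (structure) +
  fixes W :: "'a set"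
  assumes W_sub: "W \<subseteq> Arr C"
begin

lemma W_Arr [simp]: "w \<in> W \<Longrightarrow> w \<in> Arr C"
  using W_sub by auto

lemma leg_in: "leg_ok C W l \<Longrightarrow> leg_src C l \<in> Obj C \<and> leg_tgt C l \<in> Obj C"
  by (cases l) auto

lemma zigzag_in: "zigzag C W x p y \<Longrightarrow> x \<in> Obj C \<and> y \<in> Obj C"
  by (induction p arbitrary: x) (auto dest: leg_in)

lemma zigzag_category_is_category: "category (zigzag_category C W)"
  by unfold_locales (auto dest: zigzag_in simp: zigzag_append)

lemma zigzag_relations_parallel:
  assumes "(u, v) \<in> zigzag_relations C W"
  shows "parallel (zigzag_category C W) u v"
proof -
  obtain x p y x' p' y' where uv: "u = (x, p, y)" "v = (x', p', y')"
    by (metis prod_cases3)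
  show ?thesis using assms unfolding uv by cases (auto simp: parallel_def)
qed

lemma zigzag_congruence_is_congruence:
  "congruence (zigzag_category C W) (zigzag_congruence C W)"
  unfolding zigzag_congruence_def
  by (rule generated_congruence_is_congruence[OF zigzag_category_is_category
        zigzag_relations_parallel])

lemma zigzag_congruence_classes:
  "(u, v) \<in> zigzag_relations C W \<Longrightarrow> zigzag_congruence C W `` {u} = zigzag_congruence C W `` {v}"
  using congruenceD(1)[OF zigzag_congruence_is_congruence]
  by (auto simp: zigzag_congruence_def intro!: equiv_class_eq generated_congruence.base)

lemma Ho_is_category: "category (Ho C W)"
  unfolding Ho_def
  by (rule quotient_is_category[OF zigzag_category_is_category zigzag_congruence_is_congruence])

lemma localization_is_functor: "is_functor C (Ho C W) (localization C W)"
proof -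
  have "zigzag_congruence C W `` {(Dom C f, [Fwd (g \<cdot> f)], Cod C g)} =
      zigzag_congruence C W `` {(Dom C f, [Fwd f, Fwd g], Cod C g)}"
    if "f \<in> Arr C" "g \<in> Arr C" "Cod C f = Dom C g" for f g
    using zigzag_congruence_classes[OF zigzag_relations.intros(2)[OF that]] by simp
  then show ?thesis
    unfolding is_functor_def Ho_def localization_def
    using zigzag_congruence_is_congruence
    by (auto simp: quotientI zigzag_relations.intros intro!: zigzag_congruence_classes)
qed

lemma localization_inverse_arrows:
  assumes "w \<in> W"
  shows "inverse_arrows (Ho C W) (amap (localization C W) w)
           (zigzag_congruence C W `` {(Cod C w, [Bwd w], Dom C w)})"
  unfolding inverse_arrows_def Ho_def localization_def
  using assms zigzag_congruence_is_congruence
  by (auto simp: quotientI zigzag_relations.intros intro!: zigzag_congruence_classes)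

lemma localization_inverts: "w \<in> W \<Longrightarrow> isomorphism (Ho C W) (amap (localization C W) w)"
  unfolding isomorphism_def using localization_inverse_arrows by blast

end

lemma (in category) inverse_arrows_unique:
  assumes "inverse_arrows C f g" "inverse_arrows C f h"
  shows "g = h"
proof -
  have "g = (h \<cdot> f) \<cdot> g" using assms unfolding inverse_arrows_def by (metis Id_Comp)
  also have "\<dots> = h \<cdot> (f \<cdot> g)" using assms unfolding inverse_arrows_def by (intro Comp_assoc) auto
  also have "\<dots> = h" using assms unfolding inverse_arrows_def by (metis Comp_Id)
  finally show ?thesis .
qed

definition the_inverse :: "('o, 'a) category \<Rightarrow> 'a \<Rightarrow> 'a" where
  "the_inverse C f = (THE g. inverse_arrows C f g)"

fun leg_map :: "('p, 'b) category \<Rightarrow> ('o, 'a, 'p, 'b) fnctr \<Rightarrow> 'a leg \<Rightarrow> 'b" where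
  "leg_map D F (Fwd f) = amap F f"
| "leg_map D F (Bwd w) = the_inverse D (amap F w)"

fun zigzag_map ::
    "('o, 'a) category \<Rightarrow> ('p, 'b) category \<Rightarrow> ('o, 'a, 'p, 'b) fnctr \<Rightarrow> 'o \<Rightarrow> 'a leg list \<Rightarrow> 'b" where
  "zigzag_map C D F x [] = Id D (omap F x)"
| "zigzag_map C D F x (l # ls) = zigzag_map C D F (leg_tgt C l) ls \<cdot>\<^bsub>D\<^esub> leg_map D F l"

theorem localization_universal:
  fixes C :: "('o, 'a) category" and D :: "('p, 'b) category" and F :: "('o, 'a, 'p, 'b) fnctr"
  assumes "category C" "W \<subseteq> Arr C" "category D" and F: "is_functor C D F"
    and inv: "\<And>w. w \<in> W \<Longrightarrow> isomorphism D (amap F w)"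
  shows "\<exists>G. is_functor (Ho C W) D G \<and> functor_eq C (comp_functor G (localization C W)) F \<and>
     (\<forall>G'. is_functor (Ho C W) D G' \<and> functor_eq C (comp_functor G' (localization C W)) F \<longrightarrow>
        functor_eq (Ho C W) G' G)"
proof -
  interpret C: category_with_arrows C W
    using assms by (simp add: category_with_arrows_def category_with_arrows_axioms_def)
  interpret D: category D by fact
  let ?Z = "zigzag_category C W" and ?R = "zigzag_congruence C W"
  note cZ = C.zigzag_category_is_category and cR = C.zigzag_congruence_is_congruence
  note [simp] = is_functorD[OF F] cR
  have bwd: "inverse_arrows D (amap F w) (the_inverse D (amap F w))" if "w \<in> W" for w
    using inv[OF that] D.inverse_arrows_unique unfolding isomorphism_def the_inverse_def
    by (metis (no_types, lifting) theI)
  have leg: "leg_map D F l \<in> Arr D \<and> Dom D (leg_map D F l) = omap F (leg_src C l) \<and>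
      Cod D (leg_map D F l) = omap F (leg_tgt C l)" if "leg_ok C W l" for l
  proof (cases l)
    case (Bwd w)
    then show ?thesis using that bwd[of w] by (simp add: inverse_arrows_def)
  qed (use that in auto)
  have zz: "zigzag_map C D F x p \<in> Arr D \<and> Dom D (zigzag_map C D F x p) = omap F x \<and>
      Cod D (zigzag_map C D F x p) = omap F y" if "zigzag C W x p y" for x p y
    using that by (induction p arbitrary: x) (auto simp: leg)
  have app: "zigzag_map C D F x (p @ q) = zigzag_map C D F y q \<cdot>\<^bsub>D\<^esub> zigzag_map C D F x p"
    if "zigzag C W x p y" "zigzag C W y q z" for x p y q z
    using that
  proof (induction p arbitrary: x)
    case Nil
    then show ?case using zz[of y q z] D.Comp_Id[of "zigzag_map C D F y q"] by simp
  next
    case (Cons l p)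
    have l: "leg_ok C W l" "zigzag C W (leg_tgt C l) p y" using Cons.prems by auto
    show ?case using Cons.IH[OF l(2) Cons.prems(2)] leg[OF l(1)] zz[OF l(2)] zz[OF Cons.prems(2)]
      by (simp add: D.Comp_assoc)
  qed
  define E :: "('o, 'o \<times> 'a leg list \<times> 'o, 'p, 'b) fnctr"
    where "E = \<lparr>omap = omap F, amap = (\<lambda>(x, p, y). zigzag_map C D F x p)\<rparr>"
  have E: "is_functor ?Z D E"
    unfolding is_functor_def by (auto simp: E_def zz app)
  define K where "K = {(u, v). parallel ?Z u v \<and> amap E u = amap E v}"
  have K: "congruence ?Z K"
    using is_functorD[OF E] category.Comp_in[OF cZ] category.Dom_Comp[OF cZ] category.Cod_Comp[OF cZ]
    unfolding congruence_def K_def parallel_def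
    by (auto intro!: equivI simp: refl_on_def sym_def trans_def)
  have "zigzag_relations C W \<subseteq> K"
  proof
    fix r assume r: "r \<in> zigzag_relations C W"
    then obtain u v where uv: "r = (u, v)" "(u, v) \<in> zigzag_relations C W" by (cases r) auto
    obtain x p y x' p' y' where u: "u = (x, p, y)" and v: "v = (x', p', y')"
      by (metis prod_cases3)
    have "amap E (x, p, y) = amap E (x', p', y')" using uv(2)[unfolded u v]
    proof cases
      case 1 then show ?thesis using D.Comp_Id[of "Id D (omap F x)"] by (simp add: E_def)
    next
      case (2 f g)
      have "Id D (omap F (Cod C g)) \<cdot>\<^bsub>D\<^esub> amap F g = amap F g"
        using D.Id_Comp[of "amap F g"] 2 by simp
      moreover have "Id D (omap F (Cod C g)) \<cdot>\<^bsub>D\<^esub> (amap F g \<cdot>\<^bsub>D\<^esub> amap F f) = amap F g \<cdot>\<^bsub>D\<^esub> amap F f"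
        using D.Id_Comp[of "amap F g \<cdot>\<^bsub>D\<^esub> amap F f"] 2 by simp
      ultimately show ?thesis using 2 by (simp add: E_def)
    next
      case (3 w)
      then show ?thesis using bwd[of w] D.Id_Comp[of "amap F w"] D.Id_Comp[of "the_inverse D (amap F w)"]
        by (simp add: E_def inverse_arrows_def)
    next
      case (4 w)
      then show ?thesis using bwd[of w] D.Id_Comp[of "amap F w"]
        by (simp add: E_def inverse_arrows_def)
    qed
    then show "r \<in> K" using C.zigzag_relations_parallel[OF uv(2)] uv(1) u v by (simp add: K_def)
  qed
  then have "?R \<subseteq> K"
    unfolding zigzag_congruence_def by (rule generated_congruence_least[OF K])
  then have con: "amap E u = amap E v" if "(u, v) \<in> ?R" for u v
    using that by (auto simp: K_def)
  define G where "G = induced_functor E"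
  have G: "is_functor (Ho C W) D G"
    unfolding Ho_def G_def by (rule induced_functor_is_functor[OF cZ cR E con])
  have Gc: "amap G (?R `` {(x, p, y)}) = zigzag_map C D F x p" if "zigzag C W x p y" for x p y
    unfolding G_def using induced_functor_class[OF cR con] that by (simp add: E_def)
  have GF: "functor_eq C (comp_functor G (localization C W)) F"
  proof -
    have "Id D (omap F (Cod C f)) \<cdot>\<^bsub>D\<^esub> amap F f = amap F f" if "f \<in> Arr C" for f
      using D.Id_Comp[of "amap F f"] that by simp
    then show ?thesis
      by (auto simp: functor_eq_def comp_functor_def localization_def Gc)
        (simp add: G_def E_def induced_functor_def)
  qed
  have "functor_eq (Ho C W) G' G"
    if G': "is_functor (Ho C W) D G'" and e: "functor_eq C (comp_functor G' (localization C W)) F"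
    for G'
  proof -
    have o: "omap G' x = omap F x" if "x \<in> Obj C" for x
      using e that by (auto simp: functor_eq_def comp_functor_def localization_def)
    have fw: "amap G' (?R `` {(Dom C f, [Fwd f], Cod C f)}) = amap F f" if "f \<in> Arr C" for f
      using e that by (auto simp: functor_eq_def comp_functor_def localization_def)
    have bw: "amap G' (?R `` {(Cod C w, [Bwd w], Dom C w)}) = leg_map D F (Bwd w)"
      if w: "w \<in> W" for w
    proof -
      note i = C.localization_inverse_arrows[OF w, unfolded inverse_arrows_def]
      have "inverse_arrows D (amap G' (amap (localization C W) w))
          (amap G' (?R `` {(Cod C w, [Bwd w], Dom C w)}))"
        unfolding inverse_arrows_def
        using i is_functorD[OF G'] category.Dom_in[OF C.Ho_is_category]
          category.Cod_in[OF C.Ho_is_category] by metis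
      moreover have "amap G' (amap (localization C W) w) = amap F w"
        using fw[of w] w by (simp add: localization_def)
      ultimately show ?thesis using bwd[OF w] D.inverse_arrows_unique by simp
    qed
    have lg: "amap G' (?R `` {(leg_src C l, [l], leg_tgt C l)}) = leg_map D F l"
      if "leg_ok C W l" for l
      using that fw bw by (cases l) auto
    have "amap G' (?R `` {(x, p, y)}) = zigzag_map C D F x p" if "zigzag C W x p y" for x p y
      using that
    proof (induction p arbitrary: x)
      case Nil
      then show ?case using is_functorD(2)[OF G', of x] o[of x] by (auto simp: Ho_def)
    next
      case (Cons l p)
      have l: "leg_ok C W l" "leg_src C l = x" "zigzag C W (leg_tgt C l) p y"
        using Cons.prems by auto
      have z: "zigzag C W x [l] (leg_tgt C l)" using l C.leg_in by auto
      have "?R `` {(x, l # p, y)} =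
          (?R `` {(leg_tgt C l, p, y)}) \<cdot>\<^bsub>Ho C W\<^esub> (?R `` {(x, [l], leg_tgt C l)})"
        unfolding Ho_def using z l(3) by (subst quotient_Comp[OF cR]) simp_all
      moreover have "amap G' \<dots> = amap G' (?R `` {(leg_tgt C l, p, y)}) \<cdot>\<^bsub>D\<^esub>
          amap G' (?R `` {(x, [l], leg_tgt C l)})"
        using z l(3) by (intro is_functorD(6)[OF G']) (simp_all add: Ho_def quotientI)
      ultimately show ?case using Cons.IH[OF l(3)] lg[OF l(1)] l(2) by simp
    qed
    then show ?thesis
      unfolding functor_eq_def
      by (auto simp: Ho_def o Gc elim!: quotient_Arr_cases)
        (simp add: G_def E_def induced_functor_def)
  qed
  then show ?thesis using G GF by blast
qed

end

theory Submission
  imports Defs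
begin

text \<open>
  Write \<open>\<gamma>\<close> for the localization functor.  An arrow of \<open>W\<close> becomes invertible under \<open>\<gamma>\<close>, and a
  one-sided inverse of an invertible arrow is its inverse.  So if \<open>w\<close> is a weak equivalence
  that splits, and \<open>v\<close> is the arrow of \<open>C\<close> that splits it, then \<open>\<gamma> v\<close> is inverse to
  \<open>\<gamma> w\<close>, although only one of the composites of \<open>v\<close> and \<open>w\<close> is an identity in \<open>C\<close>.  Arrows
  whose image has an inverse of the form \<open>\<gamma> v\<close> are exactly the homotopical equivalences
  (\<open>homotopical_equivalence_iff\<close>), and they are closed under composition.  In the split-generated
  case every weak equivalence is therefore a homotopical equivalence.

  This gives the other two forms of the Whitehead condition: in a zigzag every backward leg
  \<open>w\<close> can be replaced by a forward leg \<open>v\<close>, so \<open>\<gamma>\<close> is full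
  (\<open>localization_full\<close>).  It is also the identity on objects, and the homotopy relation is its
  kernel, so the functor that it induces on the quotient by the homotopy relation is bijective
  on objects and on arrows, hence an isomorphism of categories.
\<close>

section \<open>Inverse arrows\<close>

lemma inverse_arrows_sym: "inverse_arrows C f g \<Longrightarrow> inverse_arrows C g f"
  unfolding inverse_arrows_def by auto

context category
begin

lemma inverse_arrows_comp:
  assumes f: "inverse_arrows C f f'" and g: "inverse_arrows C g g'" and fg: "Cod C f = Dom C g"
  shows "inverse_arrows C (g \<cdot> f) (f' \<cdot> g')"
proof -
  have cancel: "(b' \<cdot> a') \<cdot> (a \<cdot> b) = Id C (Dom C b)"
    if a: "inverse_arrows C a a'" and b: "inverse_arrows C b b'" and ba: "Cod C b = Dom C a"
    for a a' b b'
  proof -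
    note [simp] = a[unfolded inverse_arrows_def] b[unfolded inverse_arrows_def] ba
    have "(b' \<cdot> a') \<cdot> (a \<cdot> b) = b' \<cdot> (a' \<cdot> (a \<cdot> b))"
      by (rule Comp_assoc) auto
    also have "a' \<cdot> (a \<cdot> b) = (a' \<cdot> a) \<cdot> b"
      by (rule Comp_assoc[symmetric]) auto
    also have "(a' \<cdot> a) \<cdot> b = b"
      using Id_Comp[of b] by simp
    finally show ?thesis by simp
  qed
  note [simp] = f[unfolded inverse_arrows_def] g[unfolded inverse_arrows_def] fg
  show ?thesis
    using cancel[OF g f fg]
      cancel[OF inverse_arrows_sym[OF f] inverse_arrows_sym[OF g]]
    unfolding inverse_arrows_def by simp
qed

lemma left_inverse_of_isomorphism:
  assumes f: "isomorphism C f" and r: "r \<in> Arr C" "Dom C r = Cod C f" "r \<cdot> f = Id C (Dom C f)"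
  shows "inverse_arrows C f r"
proof -
  obtain h where h: "inverse_arrows C f h"
    using f by (auto simp: isomorphism_def)
  note [simp] = h[unfolded inverse_arrows_def]
  have "r = r \<cdot> (f \<cdot> h)"
    using r Comp_Id[of r] by simp
  also have "\<dots> = (r \<cdot> f) \<cdot> h"
    using r by (intro Comp_assoc[symmetric]) auto
  also have "\<dots> = h"
    using r Id_Comp[of h] by simp
  finally show ?thesis using h by simp
qed

lemma right_inverse_of_isomorphism:
  assumes f: "isomorphism C f" and s: "s \<in> Arr C" "Cod C s = Dom C f" "f \<cdot> s = Id C (Cod C f)"
  shows "inverse_arrows C f s"
proof -
  obtain h where h: "inverse_arrows C f h"
    using f by (auto simp: isomorphism_def)
  note [simp] = h[unfolded inverse_arrows_def]
  have "s = (h \<cdot> f) \<cdot> s"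
    using s Id_Comp[of s] by simp
  also have "\<dots> = h \<cdot> (f \<cdot> s)"
    using s by (intro Comp_assoc) auto
  also have "\<dots> = h"
    using s Comp_Id[of h] by simp
  finally show ?thesis using h by simp
qed

end

section \<open>Kernels and isomorphisms of categories\<close>

lemma kernel_is_congruence:
  assumes "category C" and F: "is_functor C D F"
  shows "congruence C {(f, g). parallel C f g \<and> amap F f = amap F g}"
proof -
  interpret category C by fact
  show ?thesis
    using is_functorD(6)[OF F] unfolding congruence_def parallel_def
    by (auto intro!: equivI simp: refl_on_def sym_def trans_def)
qed

lemma bijective_functor_is_isomorphism:
  assumes "category C" and F: "is_functor C D F"
    and o: "bij_betw (omap F) (Obj C) (Obj D)" and a: "bij_betw (amap F) (Arr C) (Arr D)"
  shows "isomorphism_of_categories C D F"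
proof -
  interpret category C by fact
  note [simp] = is_functorD(1,3-5)[OF F]
  define G where
    "G = \<lparr>omap = inv_into (Obj C) (omap F), amap = inv_into (Arr C) (amap F)\<rparr>"
  have [simp]: "omap G (omap F x) = x" if "x \<in> Obj C" for x
    unfolding G_def using that bij_betw_inv_into_left[OF o] by simp
  have [simp]: "amap G (amap F f) = f" if "f \<in> Arr C" for f
    unfolding G_def using that bij_betw_inv_into_left[OF a] by simp
  have obj: "Obj D = omap F ` Obj C" and arr: "Arr D = amap F ` Arr C"
    using o a by (auto simp: bij_betw_def)
  have id: "amap G (Id D (omap F x)) = Id C x" if "x \<in> Obj C" for x
    using that by (simp flip: is_functorD(2)[OF F])
  have comp: "amap G (amap F g \<cdot>\<^bsub>D\<^esub> amap F f) = g \<cdot>\<^bsub>C\<^esub> f"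
    if fg: "f \<in> Arr C" "g \<in> Arr C" "omap F (Cod C f) = omap F (Dom C g)" for f g
  proof -
    \<comment> \<open>Composability is reflected because \<open>F\<close> is injective on objects.\<close>
    have "Cod C f = Dom C g"
      using fg o by (auto simp: bij_betw_def dest: inj_onD)
    then show ?thesis
      using fg is_functorD(6)[OF F, of f g, symmetric] by simp
  qed
  have "is_functor D C G"
    unfolding is_functor_def obj arr by (auto simp: id comp)
  moreover have "functor_eq C (comp_functor G F) id_functor"
    by (simp add: functor_eq_def comp_functor_def id_functor_def)
  moreover have "functor_eq D (comp_functor F G) id_functor"
    unfolding functor_eq_def obj arr by (auto simp: comp_functor_def id_functor_def)
  ultimately show ?thesis
    unfolding isomorphism_of_categories_def using F by blast
qed

section \<open>Homotopical equivalences and the localization\<close>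

context category_with_arrows
begin

abbreviation \<gamma> :: "'a \<Rightarrow> ('o \<times> 'a leg list \<times> 'o) set" where
  "\<gamma> \<equiv> amap (localization C W)"

lemma omap_localization [simp]: "omap (localization C W) x = x"
  by (simp add: localization_def)

lemma Obj_Ho [simp]: "Obj (Ho C W) = Obj C"
  by (simp add: Ho_def)

lemmas localization_functorD [simp] = is_functorD[OF localization_is_functor, simplified]

lemma homotopical_equivalence_iff:
  "homotopical_equivalence C W f \<longleftrightarrow>
     f \<in> Arr C \<and> (\<exists>g\<in>Arr C. inverse_arrows (Ho C W) (\<gamma> f) (\<gamma> g))"
  unfolding homotopical_equivalence_def homotopy_relation_def inverse_arrows_def parallel_def
  by auto

lemma homotopical_equivalence_comp:
  assumes "homotopical_equivalence C W f" "homotopical_equivalence C W g" "Cod C f = Dom C g"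
  shows "homotopical_equivalence C W (g \<cdot> f)"
proof -
  obtain f' g' where
    f: "f \<in> Arr C" "f' \<in> Arr C" "inverse_arrows (Ho C W) (\<gamma> f) (\<gamma> f')" and
    g: "g \<in> Arr C" "g' \<in> Arr C" "inverse_arrows (Ho C W) (\<gamma> g) (\<gamma> g')"
    using assms by (auto simp: homotopical_equivalence_iff)
  have "Cod C g' = Dom C f'"
    using f g assms(3) by (simp add: inverse_arrows_def)
  then show ?thesis
    using f g assms(3) category.inverse_arrows_comp[OF Ho_is_category f(3) g(3)]
    by (auto simp: homotopical_equivalence_iff intro!: bexI[of _ "f' \<cdot> g'"])
qed

text \<open>The image of the arrow that splits \<open>w\<close> is a one-sided inverse of the isomorphism \<open>\<gamma> w\<close>,
  hence its two-sided inverse.\<close>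

lemma split_weak_equivalence_is_homotopical:
  assumes w: "w \<in> W" and "splits C w"
  shows "homotopical_equivalence C W w"
proof -
  note iso = localization_inverts[OF w]
  have "\<exists>v\<in>Arr C. inverse_arrows (Ho C W) (\<gamma> w) (\<gamma> v)"
    using \<open>splits C w\<close> unfolding splits_def
  proof
    assume "is_section C w"
    then obtain r where r: "r \<in> Arr C" "Dom C r = Cod C w" "r \<cdot> w = Id C (Dom C w)"
      by (auto simp: is_section_def)
    have "\<gamma> r \<cdot>\<^bsub>Ho C W\<^esub> \<gamma> w = Id (Ho C W) (Dom C w)"
      using w r localization_functorD(6)[of w r] by simp
    then have "inverse_arrows (Ho C W) (\<gamma> w) (\<gamma> r)"
      using w r by (intro category.left_inverse_of_isomorphism[OF Ho_is_category iso]) simp_all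
    then show ?thesis using r(1) by blast
  next
    assume "is_retraction C w"
    then obtain s where s: "s \<in> Arr C" "Cod C s = Dom C w" "w \<cdot> s = Id C (Cod C w)"
      by (auto simp: is_retraction_def)
    have "\<gamma> w \<cdot>\<^bsub>Ho C W\<^esub> \<gamma> s = Id (Ho C W) (Cod C w)"
      using w s localization_functorD(6)[of s w] by simp
    then have "inverse_arrows (Ho C W) (\<gamma> w) (\<gamma> s)"
      using w s by (intro category.right_inverse_of_isomorphism[OF Ho_is_category iso]) simp_all
    then show ?thesis using s(1) by blast
  qed
  then show ?thesis using w by (simp add: homotopical_equivalence_iff)
qed

lemma split_generated_imp_homotopical:
  assumes "split_generated C W"
  shows "weak_equivalences_are_homotopical C W"
proof -
  have "homotopical_equivalence C W f" if "f \<in> finite_compositions C {w \<in> W. splits C w}" for f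
    using that
  proof induction
    case (1 f) then show ?case by (simp add: split_weak_equivalence_is_homotopical)
  next
    case (2 f g) then show ?case by (simp add: homotopical_equivalence_comp)
  qed
  then show ?thesis
    using assms unfolding split_generated_def weak_equivalences_are_homotopical_def by blast
qed

section \<open>From homotopical equivalences to the quotient by homotopy\<close>

text \<open>The inverse of \<open>\<gamma> w\<close> is unique, so the class of a backward leg \<open>w\<close> is \<open>\<gamma> v\<close> for any
  homotopy inverse \<open>v\<close> of \<open>w\<close>; composing along the zigzag yields one arrow of \<open>C\<close>.\<close>

lemma zigzag_represented:
  assumes hom: "weak_equivalences_are_homotopical C W" and "zigzag C W x p y"
  shows "\<exists>f\<in>Arr C. Dom C f = x \<and> Cod C f = y \<and> \<gamma> f = zigzag_congruence C W `` {(x, p, y)}"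
  using assms(2)
proof (induction p arbitrary: x)
  case Nil
  then show ?case
    using localization_functorD(2)[of x] by (auto simp: Ho_def intro!: bexI[of _ "Id C x"])
next
  case (Cons l p)
  let ?R = "zigzag_congruence C W"
  have l: "leg_ok C W l" "leg_src C l = x" and p: "zigzag C W (leg_tgt C l) p y"
    using Cons.prems by auto
  obtain g where g: "g \<in> Arr C" "Dom C g = leg_tgt C l" "Cod C g = y"
    "\<gamma> g = ?R `` {(leg_tgt C l, p, y)}"
    using Cons.IH[OF p] by blast
  have "\<exists>f\<in>Arr C. Dom C f = x \<and> Cod C f = leg_tgt C l \<and> \<gamma> f = ?R `` {(x, [l], leg_tgt C l)}"
  proof (cases l)
    case (Fwd f)
    then show ?thesis using l by (auto simp: localization_def)
  next
    case (Bwd w)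
    then have w: "w \<in> W" and x: "x = Cod C w" using l by auto
    obtain v where v: "v \<in> Arr C" "inverse_arrows (Ho C W) (\<gamma> w) (\<gamma> v)"
      using hom w by (auto simp: weak_equivalences_are_homotopical_def homotopical_equivalence_iff)
    have "\<gamma> v = ?R `` {(Cod C w, [Bwd w], Dom C w)}"
      by (rule category.inverse_arrows_unique[OF Ho_is_category v(2)
            localization_inverse_arrows[OF w]])
    moreover have "Dom C v = Cod C w" "Cod C v = Dom C w"
      using v w by (simp_all add: inverse_arrows_def)
    ultimately show ?thesis using v(1) Bwd x by auto
  qed
  then obtain f where f: "f \<in> Arr C" "Dom C f = x" "Cod C f = leg_tgt C l"
    "\<gamma> f = ?R `` {(x, [l], leg_tgt C l)}" by blast
  have "zigzag C W x [l] (leg_tgt C l)"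
    using l leg_in by auto
  then have "\<gamma> (g \<cdot> f) = ?R `` {(x, l # p, y)}"
    using f g p zigzag_congruence_is_congruence localization_functorD(6)[of f g]
    by (simp add: Ho_def)
  then show ?case using f g by (intro bexI[of _ "g \<cdot> f"]) simp_all
qed

lemma localization_full:
  assumes "weak_equivalences_are_homotopical C W"
  shows "\<gamma> ` Arr C = Arr (Ho C W)"
proof
  show "\<gamma> ` Arr C \<subseteq> Arr (Ho C W)" by auto
  show "Arr (Ho C W) \<subseteq> \<gamma> ` Arr C"
  proof
    fix A assume "A \<in> Arr (Ho C W)"
    then have "A \<in> Arr (zigzag_category C W) // zigzag_congruence C W"
      by (simp add: Ho_def)
    then obtain x p y where "zigzag C W x p y" "A = zigzag_congruence C W `` {(x, p, y)}"
      by (rule quotient_Arr_cases) auto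
    then show "A \<in> \<gamma> ` Arr C"
      using zigzag_represented[OF assms, of x p y] by (metis imageI)
  qed
qed

lemma homotopy_relation_is_congruence: "congruence C (homotopy_relation C W)"
  unfolding homotopy_relation_def
  by (rule kernel_is_congruence[OF category_axioms localization_is_functor])

lemma induced_localization_class:
  "f \<in> Arr C \<Longrightarrow>
    amap (induced_functor (localization C W)) (homotopy_relation C W `` {f}) = \<gamma> f"
  by (rule induced_functor_class[OF homotopy_relation_is_congruence])
    (auto simp: homotopy_relation_def)

lemma homotopical_imp_homotopy_quotient_is_Ho:
  assumes hom: "weak_equivalences_are_homotopical C W"
  shows "homotopy_quotient_is_Ho C W"
  unfolding homotopy_quotient_is_Ho_def
proof (rule bijective_functor_is_isomorphism)
  let ?R = "homotopy_relation C W" and ?G = "induced_functor (localization C W)"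
  note R = homotopy_relation_is_congruence
  show "category (quotient_category C ?R)"
    by (rule quotient_is_category[OF category_axioms R])
  show "is_functor (quotient_category C ?R) (Ho C W) ?G"
    by (rule induced_functor_is_functor[OF category_axioms R localization_is_functor])
      (auto simp: homotopy_relation_def)
  show "bij_betw (omap ?G) (Obj (quotient_category C ?R)) (Obj (Ho C W))"
    by (simp add: induced_functor_def bij_betw_def inj_on_def)
  have classes: "?R `` {f} = ?R `` {g}" if fg: "f \<in> Arr C" "g \<in> Arr C" "\<gamma> f = \<gamma> g" for f g
  proof -
    \<comment> \<open>\<open>\<gamma>\<close> is the identity on objects, so arrows with the same image are parallel.\<close>
    have "parallel C f g"
      using fg localization_functorD(4,5)[of f] localization_functorD(4,5)[of g]
      by (simp add: parallel_def)
    then show ?thesis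
      using fg by (intro equiv_class_eq[OF congruenceD(1)[OF R]]) (simp add: homotopy_relation_def)
  qed
  have inj: "inj_on (amap ?G) (Arr C // ?R)"
  proof (rule inj_onI)
    fix A B assume "A \<in> Arr C // ?R" "B \<in> Arr C // ?R" and AB: "amap ?G A = amap ?G B"
    then obtain f g where "f \<in> Arr C" "A = ?R `` {f}" "g \<in> Arr C" "B = ?R `` {g}"
      by (meson quotient_Arr_cases)
    then show "A = B"
      using AB classes[of f g] by (simp add: induced_localization_class)
  qed
  have "Arr C // ?R = (\<lambda>f. ?R `` {f}) ` Arr C"
    by (auto simp: quotient_def)
  then have "amap ?G ` (Arr C // ?R) = \<gamma> ` Arr C"
    by (simp add: image_image induced_localization_class)
  then show "bij_betw (amap ?G) (Arr (quotient_category C ?R)) (Arr (Ho C W))"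
    using inj localization_full[OF hom] by (simp add: bij_betw_def)
qed

lemma homotopy_quotient_imp_localization_is_quotient:
  assumes "homotopy_quotient_is_Ho C W"
  shows "localization_is_quotient C W"
proof -
  have "functor_eq C
      (comp_functor (induced_functor (localization C W)) (quotient_functor (homotopy_relation C W)))
      (localization C W)"
    by (simp add: functor_eq_def comp_functor_def quotient_functor_def induced_localization_class)
      (simp add: induced_functor_def)
  then show ?thesis
    using assms homotopy_relation_is_congruence
    unfolding localization_is_quotient_def homotopy_quotient_is_Ho_def by blast
qed

end

section \<open>The Whitehead condition\<close>

theorem proposition3p1p21:
  fixes C :: "('o, 'a) category" and W :: "'a set"
  assumes "category_with_weak_equivalences C W"
    and "split_generated C W"
  shows "Whitehead_condition C W"
proof -
  interpret category_with_arrows C W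
    using assms(1)
    by (simp add: category_with_weak_equivalences_def category_with_arrows_def
        category_with_arrows_axioms_def)
  have "weak_equivalences_are_homotopical C W"
    by (rule split_generated_imp_homotopical[OF assms(2)])
  then show ?thesis
    unfolding Whitehead_condition_def
    using homotopical_imp_homotopy_quotient_is_Ho homotopy_quotient_imp_localization_is_quotient
    by blast
qed

end
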